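(* For every $\mathrm{HyperQPTL}$ sentence $\varphi_H$ there exists a trace-prefixed hypertrace sentence $\varphi$ such that for all sets of infinite traces $T\subseteq(2^{\mathcal{X}})^\omega$, $T\models_{HQ}\varphi_H$ iff $T\models\varphi$. Conversely, for every trace-prefixed hypertrace sentence $\varphi$ there exists a $\mathrm{HyperQPTL}$ sentence $\varphi_H$ such that for all sets of infinite traces $T\subseteq(2^{\mathcal{X}})^\omega$, $T\models_{HQ}\varphi_H$ iff $T\models\varphi$.
   Context: Fix a finite set $\mathcal{X}$ of propositional variables; a trace is an infinite sequence of subsets of $\mathcal{X}$, $(2^{\mathcal{X}})^\omega$ the set of all traces, $\tau[k]$ its $k$-th element. Hypertrace logic: formulas over trace variables and disjoint time variables, $\varphi ::= \exists\pi\,\varphi \mid \exists^{T}\pi\,\varphi \mid \exists i\,\varphi \mid \neg\varphi \mid \varphi\vee\varphi \mid i<j \mid i=j \mid x(\pi,i)$, $x\in\mathcal{X}$, with dual abbreviations $\forall,\forall^T$. Semantics over $T\subseteq(2^{\mathcal{X}})^\omega$ with trace and time assignments: $\exists\pi$ ranges over all of $(2^{\mathcal{X}})^\omega$, $\exists^T\pi$ over $T$, $\exists i$ over $\mathbb{N}$; $<,=$ as in $\mathbb{N}$; $x(\pi,i)$ holds iff $x$ belongs to the valuation at position (value of $i$) of the trace assigned to $\pi$; $T\models\varphi$ iff some assignments satisfy $\varphi$ over $T$. Trace-prefixed hypertrace formulas: $\varphi ::= \exists\pi\,\varphi\mid\exists^T\pi\,\varphi\mid\neg\varphi\mid\psi$,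 $\psi ::= \exists i\,\psi\mid\psi\vee\psi\mid\neg\psi\mid i<j\mid i=j\mid x(\pi,i)$; a sentence has no free variables. HyperQPTL: $\psi ::= \mathbf{X}\psi\mid\psi\,\mathbf{U}\,\psi\mid\neg\psi\mid\psi\vee\psi\mid q\mid a_\pi$ and $\varphi ::= \exists q\,\varphi\mid\forall q\,\varphi\mid\exists\pi\,\varphi\mid\forall\pi\,\varphi\mid\psi$, with trace variables $\pi$ and $q,a\in\mathcal{X}$. Evaluated on a trace assignment $\Pi$, a set $T$ of traces and a position $i\in\mathbb{N}$: $(\Pi,T,i)\models_{HQ}\exists q\,\psi$ iff there is $\tau\in(2^{\{q\}})^\omega$ with $(\Pi[\pi_q\mapsto\tau],T,i)\models_{HQ}\psi$ ($\forall q$ dually, for all such $\tau$); $\exists\pi\,\psi$ iff there is $\tau\in T$ with $(\Pi[\pi\mapsto\tau],T,i)\models_{HQ}\psi$ ($\forall\pi$ dually); $q$ holds iff $q\in\Pi(\pi_q)[i]$; $a_\pi$ holds iff $a\in\Pi(\pi)[i]$; Boolean connectives as usual; $\mathbf{X}\psi$ iff $(\Pi,T,i+1)\models_{HQ}\psi$; $\psi_1\mathbf{U}\psi_2$ iff there is $j\ge i$ with $(\Pi,T,j)\models_{HQ}\psi_2$ and $(\Pi,T,j')\models_{HQ}\psi_1$ for all $i\le j'<j$. $T\models_{HQ}\varphi$ iff there is $\Pi$ with $(\Pi,T,0)\models_{HQ}\varphi$.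
   Formalization: Quantified propositions q in HyperQPTL may be any names from an infinite supply, not only elements of the finite set X (only a in a_π must lie in X); with q restricted to X the converse is false, e.g. for empty X there are no HyperQPTL formulas at all. *)

theory Defs
  imports Main "HOL-Library.Infinite_Typeclass"
begin

text \<open>
  Names of propositional variables are the elements of a type \<open>'p\<close>; the fixed finite set of
  propositional variables that occur in traces is a parameter \<open>X :: 'p set\<close>.
\<close>

type_synonym 'p trace = "nat \<Rightarrow> 'p set"

definition traces :: "'p set \<Rightarrow> 'p trace set" where
  "traces X = {\<tau>. \<forall>k. \<tau> k \<subseteq> X}"


section \<open>Hypertrace logic\<close>

text \<open>
  Trace variables and time variables are both named by natural numbers. They are nevertheless
  disjoint: the constructors determine which kind of variable a name refers to, and the two kinds
  have separate assignments.
\<close>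

datatype 'p ht =
    HExAll nat "'p ht"   \<comment> \<open>\<open>\<exists>\<pi>\<close>, over all traces\<close>
  | HExT nat "'p ht"     \<comment> \<open>\<open>\<exists>\<^sup>T\<pi>\<close>, over the traces in \<open>T\<close>\<close>
  | HExTime nat "'p ht"
  | HNot "'p ht"
  | HOr "'p ht" "'p ht"
  | HLess nat nat
  | HEq nat nat
  | HProp 'p nat nat     \<comment> \<open>\<open>HProp x \<pi> i\<close> is \<open>x(\<pi>,i)\<close>\<close>

primrec ht_sat ::
  "'p set \<Rightarrow> 'p trace set \<Rightarrow> (nat \<Rightarrow> 'p trace) \<Rightarrow> (nat \<Rightarrow> nat) \<Rightarrow> 'p ht \<Rightarrow> bool" where
  "ht_sat X T \<Pi> \<Theta> (HExAll v \<phi>) \<longleftrightarrow> (\<exists>\<tau>\<in>traces X. ht_sat X T (\<Pi>(v := \<tau>)) \<Theta> \<phi>)"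
| "ht_sat X T \<Pi> \<Theta> (HExT v \<phi>) \<longleftrightarrow> (\<exists>\<tau>\<in>T. ht_sat X T (\<Pi>(v := \<tau>)) \<Theta> \<phi>)"
| "ht_sat X T \<Pi> \<Theta> (HExTime i \<phi>) \<longleftrightarrow> (\<exists>n. ht_sat X T \<Pi> (\<Theta>(i := n)) \<phi>)"
| "ht_sat X T \<Pi> \<Theta> (HNot \<phi>) \<longleftrightarrow> \<not> ht_sat X T \<Pi> \<Theta> \<phi>"
| "ht_sat X T \<Pi> \<Theta> (HOr \<phi> \<psi>) \<longleftrightarrow> ht_sat X T \<Pi> \<Theta> \<phi> \<or> ht_sat X T \<Pi> \<Theta> \<psi>"
| "ht_sat X T \<Pi> \<Theta> (HLess i j) \<longleftrightarrow> \<Theta> i < \<Theta> j"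
| "ht_sat X T \<Pi> \<Theta> (HEq i j) \<longleftrightarrow> \<Theta> i = \<Theta> j"
| "ht_sat X T \<Pi> \<Theta> (HProp x v i) \<longleftrightarrow> x \<in> \<Pi> v (\<Theta> i)"

definition ht_models :: "'p set \<Rightarrow> 'p trace set \<Rightarrow> 'p ht \<Rightarrow> bool" where
  "ht_models X T \<phi> \<longleftrightarrow> (\<exists>\<Pi> \<Theta>. (\<forall>v. \<Pi> v \<in> traces X) \<and> ht_sat X T \<Pi> \<Theta> \<phi>)"

primrec ht_props :: "'p ht \<Rightarrow> 'p set" where
  "ht_props (HExAll v \<phi>) = ht_props \<phi>"
| "ht_props (HExT v \<phi>) = ht_props \<phi>"
| "ht_props (HExTime i \<phi>) = ht_props \<phi>"
| "ht_props (HNot \<phi>) = ht_props \<phi>"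
| "ht_props (HOr \<phi> \<psi>) = ht_props \<phi> \<union> ht_props \<psi>"
| "ht_props (HLess i j) = {}"
| "ht_props (HEq i j) = {}"
| "ht_props (HProp x v i) = {x}"

primrec ht_free_traces :: "'p ht \<Rightarrow> nat set" where
  "ht_free_traces (HExAll v \<phi>) = ht_free_traces \<phi> - {v}"
| "ht_free_traces (HExT v \<phi>) = ht_free_traces \<phi> - {v}"
| "ht_free_traces (HExTime i \<phi>) = ht_free_traces \<phi>"
| "ht_free_traces (HNot \<phi>) = ht_free_traces \<phi>"
| "ht_free_traces (HOr \<phi> \<psi>) = ht_free_traces \<phi> \<union> ht_free_traces \<psi>"
| "ht_free_traces (HLess i j) = {}"
| "ht_free_traces (HEq i j) = {}"
| "ht_free_traces (HProp x v i) = {v}"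

primrec ht_free_times :: "'p ht \<Rightarrow> nat set" where
  "ht_free_times (HExAll v \<phi>) = ht_free_times \<phi>"
| "ht_free_times (HExT v \<phi>) = ht_free_times \<phi>"
| "ht_free_times (HExTime i \<phi>) = ht_free_times \<phi> - {i}"
| "ht_free_times (HNot \<phi>) = ht_free_times \<phi>"
| "ht_free_times (HOr \<phi> \<psi>) = ht_free_times \<phi> \<union> ht_free_times \<psi>"
| "ht_free_times (HLess i j) = {i, j}"
| "ht_free_times (HEq i j) = {i, j}"
| "ht_free_times (HProp x v i) = {i}"

definition ht_sentence :: "'p set \<Rightarrow> 'p ht \<Rightarrow> bool" where
  "ht_sentence X \<phi> \<longleftrightarrow> ht_props \<phi> \<subseteq> X \<and> ht_free_traces \<phi> = {} \<and> ht_free_times \<phi> = {}"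

inductive no_trace_quant :: "'p ht \<Rightarrow> bool" where
  "no_trace_quant \<psi> \<Longrightarrow> no_trace_quant (HExTime i \<psi>)"
| "no_trace_quant \<psi> \<Longrightarrow> no_trace_quant \<psi>' \<Longrightarrow> no_trace_quant (HOr \<psi> \<psi>')"
| "no_trace_quant \<psi> \<Longrightarrow> no_trace_quant (HNot \<psi>)"
| "no_trace_quant (HLess i j)"
| "no_trace_quant (HEq i j)"
| "no_trace_quant (HProp x v i)"

inductive trace_prefixed :: "'p ht \<Rightarrow> bool" where
  "trace_prefixed \<phi> \<Longrightarrow> trace_prefixed (HExAll v \<phi>)"
| "trace_prefixed \<phi> \<Longrightarrow> trace_prefixed (HExT v \<phi>)"
| "trace_prefixed \<phi> \<Longrightarrow> trace_prefixed (HNot \<phi>)"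
| "no_trace_quant \<psi> \<Longrightarrow> trace_prefixed \<psi>"


section \<open>HyperQPTL\<close>

text \<open>
  Variables for traces are either ordinary trace variables or the reserved variables \<open>\<pi>\<^sub>q\<close>
  that hold the value of the quantified proposition \<open>q\<close>.
\<close>

datatype 'p hqvar = TVar nat | PVar 'p

datatype 'p hq_body =
    QNext "'p hq_body"
  | QUntil "'p hq_body" "'p hq_body"
  | QNot "'p hq_body"
  | QOr "'p hq_body" "'p hq_body"
  | QProp 'p             \<comment> \<open>\<open>q\<close>\<close>
  | QIdx 'p nat          \<comment> \<open>\<open>QIdx a \<pi>\<close> is \<open>a\<^sub>\<pi>\<close>\<close>

datatype 'p hq =
    QExProp 'p "'p hq"
  | QAllProp 'p "'p hq"
  | QExTr nat "'p hq"
  | QAllTr nat "'p hq"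
  | QBody "'p hq_body"

primrec hq_body_sat :: "('p hqvar \<Rightarrow> 'p trace) \<Rightarrow> 'p trace set \<Rightarrow> nat \<Rightarrow> 'p hq_body \<Rightarrow> bool" where
  "hq_body_sat \<Pi> T i (QNext \<psi>) \<longleftrightarrow> hq_body_sat \<Pi> T (i + 1) \<psi>"
| "hq_body_sat \<Pi> T i (QUntil \<psi> \<psi>') \<longleftrightarrow>
     (\<exists>j\<ge>i. hq_body_sat \<Pi> T j \<psi>' \<and> (\<forall>j'. i \<le> j' \<and> j' < j \<longrightarrow> hq_body_sat \<Pi> T j' \<psi>))"
| "hq_body_sat \<Pi> T i (QNot \<psi>) \<longleftrightarrow> \<not> hq_body_sat \<Pi> T i \<psi>"
| "hq_body_sat \<Pi> T i (QOr \<psi> \<psi>') \<longleftrightarrow> hq_body_sat \<Pi> T i \<psi> \<or> hq_body_sat \<Pi> T i \<psi>'"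
| "hq_body_sat \<Pi> T i (QProp q) \<longleftrightarrow> q \<in> \<Pi> (PVar q) i"
| "hq_body_sat \<Pi> T i (QIdx a v) \<longleftrightarrow> a \<in> \<Pi> (TVar v) i"

primrec hq_sat :: "('p hqvar \<Rightarrow> 'p trace) \<Rightarrow> 'p trace set \<Rightarrow> nat \<Rightarrow> 'p hq \<Rightarrow> bool" where
  "hq_sat \<Pi> T i (QExProp q \<phi>) \<longleftrightarrow> (\<exists>\<tau>\<in>traces {q}. hq_sat (\<Pi>(PVar q := \<tau>)) T i \<phi>)"
| "hq_sat \<Pi> T i (QAllProp q \<phi>) \<longleftrightarrow> (\<forall>\<tau>\<in>traces {q}. hq_sat (\<Pi>(PVar q := \<tau>)) T i \<phi>)"
| "hq_sat \<Pi> T i (QExTr v \<phi>) \<longleftrightarrow> (\<exists>\<tau>\<in>T. hq_sat (\<Pi>(TVar v := \<tau>)) T i \<phi>)"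
| "hq_sat \<Pi> T i (QAllTr v \<phi>) \<longleftrightarrow> (\<forall>\<tau>\<in>T. hq_sat (\<Pi>(TVar v := \<tau>)) T i \<phi>)"
| "hq_sat \<Pi> T i (QBody \<psi>) \<longleftrightarrow> hq_body_sat \<Pi> T i \<psi>"

definition hq_models :: "'p set \<Rightarrow> 'p trace set \<Rightarrow> 'p hq \<Rightarrow> bool" where
  "hq_models X T \<phi> \<longleftrightarrow>
     (\<exists>\<Pi>. (\<forall>v. \<Pi> (TVar v) \<in> traces X) \<and> (\<forall>q. \<Pi> (PVar q) \<in> traces {q}) \<and> hq_sat \<Pi> T 0 \<phi>)"

primrec hq_body_idx_props :: "'p hq_body \<Rightarrow> 'p set" where
  "hq_body_idx_props (QNext \<psi>) = hq_body_idx_props \<psi>"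
| "hq_body_idx_props (QUntil \<psi> \<psi>') = hq_body_idx_props \<psi> \<union> hq_body_idx_props \<psi>'"
| "hq_body_idx_props (QNot \<psi>) = hq_body_idx_props \<psi>"
| "hq_body_idx_props (QOr \<psi> \<psi>') = hq_body_idx_props \<psi> \<union> hq_body_idx_props \<psi>'"
| "hq_body_idx_props (QProp q) = {}"
| "hq_body_idx_props (QIdx a v) = {a}"

primrec hq_idx_props :: "'p hq \<Rightarrow> 'p set" where
  "hq_idx_props (QExProp q \<phi>) = hq_idx_props \<phi>"
| "hq_idx_props (QAllProp q \<phi>) = hq_idx_props \<phi>"
| "hq_idx_props (QExTr v \<phi>) = hq_idx_props \<phi>"
| "hq_idx_props (QAllTr v \<phi>) = hq_idx_props \<phi>"
| "hq_idx_props (QBody \<psi>) = hq_body_idx_props \<psi>"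

primrec hq_body_vars :: "'p hq_body \<Rightarrow> 'p hqvar set" where
  "hq_body_vars (QNext \<psi>) = hq_body_vars \<psi>"
| "hq_body_vars (QUntil \<psi> \<psi>') = hq_body_vars \<psi> \<union> hq_body_vars \<psi>'"
| "hq_body_vars (QNot \<psi>) = hq_body_vars \<psi>"
| "hq_body_vars (QOr \<psi> \<psi>') = hq_body_vars \<psi> \<union> hq_body_vars \<psi>'"
| "hq_body_vars (QProp q) = {PVar q}"
| "hq_body_vars (QIdx a v) = {TVar v}"

primrec hq_free :: "'p hq \<Rightarrow> 'p hqvar set" where
  "hq_free (QExProp q \<phi>) = hq_free \<phi> - {PVar q}"
| "hq_free (QAllProp q \<phi>) = hq_free \<phi> - {PVar q}"
| "hq_free (QExTr v \<phi>) = hq_free \<phi> - {TVar v}"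
| "hq_free (QAllTr v \<phi>) = hq_free \<phi> - {TVar v}"
| "hq_free (QBody \<psi>) = hq_body_vars \<psi>"

text \<open>
  Only the propositions \<open>a\<close> in atoms \<open>a\<^sub>\<pi>\<close> are read off traces, so only they have
  to lie in \<open>X\<close>. Quantified propositions are bound names and may be any element of \<open>'p\<close>.
  If they too had to come from the finite set \<open>X\<close>, a formula could have at most \<open>card X\<close> of
  them in scope at once (an inner quantifier hides an outer one with the same name), whereas
  hypertrace formulas nest quantifiers over arbitrary traces without bound.
\<close>

definition hq_sentence :: "'p set \<Rightarrow> 'p hq \<Rightarrow> bool" where
  "hq_sentence X \<phi> \<longleftrightarrow> hq_idx_props \<phi> \<subseteq> X \<and> hq_free \<phi> = {}"

end

theory Submission
  imports Defs
begin

text \<open>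
  From HyperQPTL to hypertrace logic, the body is translated as linear temporal logic into
  first-order logic of order, and a quantified proposition becomes a quantified trace of which only
  one fixed proposition \<open>x0 \<in> X\<close> is read. If \<open>X\<close> is empty there is no such proposition, but then
  only two sets \<open>T\<close> exist and each of the four possible truth tables is definable.

  Conversely, a trace quantified over all traces becomes one quantified proposition per element of
  \<open>X\<close>, and a time variable becomes a quantified proposition that holds at exactly one position.
  Time quantifiers may occur below disjunctions, so they have to be pulled to the front; this is
  harmless because quantified propositions, unlike traces in \<open>T\<close>, have a nonempty range.
\<close>

section \<open>From HyperQPTL to hypertrace logic\<close>

abbreviation ht_and :: "'p ht \<Rightarrow> 'p ht \<Rightarrow> 'p ht" where
  "ht_and \<phi> \<psi> \<equiv> HNot (HOr (HNot \<phi>) (HNot \<psi>))"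

text \<open>The argument \<open>n\<close> is the time variable of the current position; larger names may be overwritten.\<close>

primrec body_to_ht :: "'p \<Rightarrow> ('p hqvar \<Rightarrow> nat) \<Rightarrow> nat \<Rightarrow> 'p hq_body \<Rightarrow> 'p ht" where
  "body_to_ht x0 c n (QNext \<psi>) =
     HExTime (n + 1) (ht_and
       (ht_and (HLess n (n + 1)) (HNot (HExTime (n + 2) (ht_and (HLess n (n + 2)) (HLess (n + 2) (n + 1))))))
       (body_to_ht x0 c (n + 1) \<psi>))"
| "body_to_ht x0 c n (QUntil \<psi> \<psi>') =
     HExTime (n + 1) (ht_and
       (ht_and (HNot (HLess (n + 1) n)) (body_to_ht x0 c (n + 1) \<psi>'))
       (HNot (HExTime (n + 2) (ht_and
         (ht_and (HNot (HLess (n + 2) n)) (HLess (n + 2) (n + 1)))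
         (HNot (body_to_ht x0 c (n + 2) \<psi>))))))"
| "body_to_ht x0 c n (QNot \<psi>) = HNot (body_to_ht x0 c n \<psi>)"
| "body_to_ht x0 c n (QOr \<psi> \<psi>') = HOr (body_to_ht x0 c n \<psi>) (body_to_ht x0 c n \<psi>')"
| "body_to_ht x0 c n (QProp q) = HProp x0 (c (PVar q)) n"
| "body_to_ht x0 c n (QIdx a v) = HProp a (c (TVar v)) n"

text \<open>The two sides live over different alphabets: a value of \<open>PVar q\<close> is a trace
  over \<open>{q}\<close>, its counterpart a trace over \<open>X\<close>. Hence only
  \<open>q\<close> and \<open>x0\<close> are compared there, and equality is demanded of ordinary
  trace variables alone.\<close>

fun vars_agree :: "'p \<Rightarrow> ('p hqvar \<Rightarrow> 'p trace) \<Rightarrow> 'p trace \<Rightarrow> 'p hqvar \<Rightarrow> bool" where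
  "vars_agree x0 \<Pi> \<tau> (PVar q) \<longleftrightarrow> (\<forall>k. q \<in> \<Pi> (PVar q) k \<longleftrightarrow> x0 \<in> \<tau> k)"
| "vars_agree x0 \<Pi> \<tau> (TVar v) \<longleftrightarrow> \<Pi> (TVar v) = \<tau>"

lemma vars_agree_cong: "\<Pi> w = \<Pi>' w \<Longrightarrow> vars_agree x0 \<Pi> \<tau> w = vars_agree x0 \<Pi>' \<tau> w"
  by (cases w) auto

text \<open>Of the time assignment only \<open>\<Theta> n\<close> enters the claim, so the names
  above \<open>n\<close> can be reused freely in nested subformulas.\<close>

lemma ht_sat_body_to_ht:
  assumes "\<forall>w\<in>hq_body_vars \<psi>. vars_agree x0 \<Pi> (\<Sigma> (c w)) w"
  shows "ht_sat X T \<Sigma> \<Theta> (body_to_ht x0 c n \<psi>) \<longleftrightarrow> hq_body_sat \<Pi> T (\<Theta> n) \<psi>"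
  using assms
proof (induction \<psi> arbitrary: n \<Theta>)
  case (QNext \<psi>)
  \<comment> \<open>The \<open>QNext\<close> clause defines the successor by order alone: a larger
    position with nothing strictly between.\<close>
  have succ: "(k < m \<and> \<not> (\<exists>l. k < l \<and> l < m)) \<longleftrightarrow> m = Suc k" for k m :: nat
    using less_Suc_eq_le not_less_eq_eq by (metis Suc_lessI lessI linorder_not_less less_eq_Suc_le)
  show ?case
    using QNext succ by simp
next
  case (QUntil \<psi>1 \<psi>2)
  then show ?case
    by (simp add: not_less) (metis linorder_not_less)
qed auto

lemma ht_free_times_body_to_ht: "ht_free_times (body_to_ht x0 c n \<psi>) \<subseteq> {n}"
proof (induction \<psi> arbitrary: n)
  case (QNext \<psi>)
  from QNext[of "n + 1"] show ?case by auto
next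
  case (QUntil \<psi>1 \<psi>2)
  from QUntil(1)[of "n + 2"] QUntil(2)[of "n + 1"] show ?case by auto
qed auto

lemma ht_free_traces_body_to_ht: "ht_free_traces (body_to_ht x0 c n \<psi>) \<subseteq> c ` hq_body_vars \<psi>"
  by (induction \<psi> arbitrary: n) fastforce+

lemma ht_props_body_to_ht: "ht_props (body_to_ht x0 c n \<psi>) \<subseteq> insert x0 (hq_body_idx_props \<psi>)"
  by (induction \<psi> arbitrary: n) fastforce+

lemma no_trace_quant_body_to_ht: "no_trace_quant (body_to_ht x0 c n \<psi>)"
  by (induction \<psi> arbitrary: n) (auto intro!: no_trace_quant.intros)

section \<open>Quantifier prefixes of HyperQPTL formulas\<close>

text \<open>\<open>n\<close> is meant to exceed every name in use, so a requantified variable gets a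
  new name, and \<open>c\<close> records the current one. The body first pins time variable 0 to
  position 0, the only number with none below it.\<close>

primrec hq_to_ht :: "'p \<Rightarrow> ('p hqvar \<Rightarrow> nat) \<Rightarrow> nat \<Rightarrow> 'p hq \<Rightarrow> 'p ht" where
  "hq_to_ht x0 c n (QExProp q \<phi>) = HExAll n (hq_to_ht x0 (c(PVar q := n)) (Suc n) \<phi>)"
| "hq_to_ht x0 c n (QAllProp q \<phi>) =
     HNot (HExAll n (HNot (hq_to_ht x0 (c(PVar q := n)) (Suc n) \<phi>)))"
| "hq_to_ht x0 c n (QExTr v \<phi>) = HExT n (hq_to_ht x0 (c(TVar v := n)) (Suc n) \<phi>)"
| "hq_to_ht x0 c n (QAllTr v \<phi>) =
     HNot (HExT n (HNot (hq_to_ht x0 (c(TVar v := n)) (Suc n) \<phi>)))"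
| "hq_to_ht x0 c n (QBody \<psi>) =
     HExTime 0 (ht_and (HNot (HExTime 1 (HLess 1 0))) (body_to_ht x0 c 0 \<psi>))"

lemma trace_prefixed_hq_to_ht: "trace_prefixed (hq_to_ht x0 c n \<phi>)"
  by (induction \<phi> arbitrary: c n)
    (auto intro!: trace_prefixed.intros(1,2,3),
     auto intro!: trace_prefixed.intros(4) no_trace_quant.intros no_trace_quant_body_to_ht)

lemma ht_free_times_hq_to_ht: "ht_free_times (hq_to_ht x0 c n \<phi>) = {}"
  using ht_free_times_body_to_ht by (induction \<phi> arbitrary: c n) fastforce+

lemma ht_props_hq_to_ht: "ht_props (hq_to_ht x0 c n \<phi>) \<subseteq> insert x0 (hq_idx_props \<phi>)"
  using ht_props_body_to_ht by (induction \<phi> arbitrary: c n) fastforce+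

lemma image_fun_upd_diff: "(c(u := n)) ` V - {n} \<subseteq> c ` (V - {u})"
  by auto

lemma ht_free_traces_hq_to_ht: "ht_free_traces (hq_to_ht x0 c n \<phi>) \<subseteq> c ` hq_free \<phi>"
proof (induction \<phi> arbitrary: c n)
  case (QExProp q \<phi>)
  have "ht_free_traces (hq_to_ht x0 (c(PVar q := n)) (Suc n) \<phi>) - {n} \<subseteq> c ` (hq_free \<phi> - {PVar q})"
    using order_trans[OF Diff_mono[OF QExProp order_refl] image_fun_upd_diff] .
  then show ?case by simp
next
  case (QAllProp q \<phi>)
  have "ht_free_traces (hq_to_ht x0 (c(PVar q := n)) (Suc n) \<phi>) - {n} \<subseteq> c ` (hq_free \<phi> - {PVar q})"
    using order_trans[OF Diff_mono[OF QAllProp order_refl] image_fun_upd_diff] .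
  then show ?case by simp
next
  case (QExTr v \<phi>)
  have "ht_free_traces (hq_to_ht x0 (c(TVar v := n)) (Suc n) \<phi>) - {n} \<subseteq> c ` (hq_free \<phi> - {TVar v})"
    using order_trans[OF Diff_mono[OF QExTr order_refl] image_fun_upd_diff] .
  then show ?case by simp
next
  case (QAllTr v \<phi>)
  have "ht_free_traces (hq_to_ht x0 (c(TVar v := n)) (Suc n) \<phi>) - {n} \<subseteq> c ` (hq_free \<phi> - {TVar v})"
    using order_trans[OF Diff_mono[OF QAllTr order_refl] image_fun_upd_diff] .
  then show ?case by simp
next
  case (QBody \<psi>)
  then show ?case using ht_free_traces_body_to_ht by fastforce
qed

text \<open>This is the invariant of the induction over the prefix: \<open>c w < n\<close>
  guarantees that writing to name \<open>n\<close> leaves the traces of the other variables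
  intact.\<close>

lemma vars_agree_update:
  assumes "\<forall>w\<in>V - {u}. c w < n \<and> vars_agree x0 \<Pi> (\<Sigma> (c w)) w"
    and "vars_agree x0 (\<Pi>(u := \<sigma>)) \<tau> u"
  shows "\<forall>w\<in>V. (c(u := n)) w < Suc n \<and>
           vars_agree x0 (\<Pi>(u := \<sigma>)) ((\<Sigma>(n := \<tau>)) ((c(u := n)) w)) w"
proof
  fix w assume "w \<in> V"
  show "(c(u := n)) w < Suc n \<and>
          vars_agree x0 (\<Pi>(u := \<sigma>)) ((\<Sigma>(n := \<tau>)) ((c(u := n)) w)) w"
  proof (cases "w = u")
    case False
    with assms(1) \<open>w \<in> V\<close> have "c w < n" "vars_agree x0 \<Pi> (\<Sigma> (c w)) w" by auto
    with False show ?thesis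
      using vars_agree_cong[of \<Pi> w "\<Pi>(u := \<sigma>)"] by auto
  qed (use assms(2) in auto)
qed

lemma ht_sat_hq_to_ht:
  assumes "x0 \<in> X"
    and "\<forall>w\<in>hq_free \<phi>. c w < n \<and> vars_agree x0 \<Pi> (\<Sigma> (c w)) w"
  shows "ht_sat X T \<Sigma> \<Theta> (hq_to_ht x0 c n \<phi>) \<longleftrightarrow> hq_sat \<Pi> T 0 \<phi>"
proof -
  \<comment> \<open>Agreement is total in both directions, so quantifying over
    \<open>traces {q}\<close> and over \<open>traces X\<close> has the same effect. The assumption
    \<open>x0 \<in> X\<close> keeps this first witness inside \<open>traces X\<close>.\<close>
  have to_X: "\<exists>\<tau>\<in>traces X. vars_agree x0 (\<Pi>(PVar q := \<sigma>)) \<tau> (PVar q)" for q \<Pi> \<sigma>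
    using assms(1)
    by (intro bexI[of _ "\<lambda>k. if q \<in> \<sigma> k then {x0} else {}"]) (auto simp: traces_def)
  have from_X: "\<exists>\<sigma>\<in>traces {q}. vars_agree x0 (\<Pi>(PVar q := \<sigma>)) \<tau> (PVar q)" for q \<Pi> \<tau>
    by (intro bexI[of _ "\<lambda>k. if x0 \<in> \<tau> k then {q} else {}"]) (auto simp: traces_def)
  show ?thesis
    using assms(2)
  proof (induction \<phi> arbitrary: c n \<Pi> \<Sigma>)
    case (QExProp q \<phi>)
    note IH = QExProp.IH[OF vars_agree_update[OF QExProp.prems[unfolded hq_free.simps]]]
    show ?case unfolding hq_to_ht.simps hq_sat.simps ht_sat.simps using to_X from_X IH by meson
  next
    case (QAllProp q \<phi>)
    note IH = QAllProp.IH[OF vars_agree_update[OF QAllProp.prems[unfolded hq_free.simps]]]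
    show ?case unfolding hq_to_ht.simps hq_sat.simps ht_sat.simps using to_X from_X IH by meson
  next
    case (QExTr v \<phi>)
    have "ht_sat X T (\<Sigma>(n := \<tau>)) \<Theta> (hq_to_ht x0 (c(TVar v := n)) (Suc n) \<phi>) \<longleftrightarrow>
        hq_sat (\<Pi>(TVar v := \<tau>)) T 0 \<phi>" for \<tau>
      by (rule QExTr.IH[OF vars_agree_update[OF QExTr.prems[unfolded hq_free.simps]]]) simp
    then show ?case by simp
  next
    case (QAllTr v \<phi>)
    have "ht_sat X T (\<Sigma>(n := \<tau>)) \<Theta> (hq_to_ht x0 (c(TVar v := n)) (Suc n) \<phi>) \<longleftrightarrow>
        hq_sat (\<Pi>(TVar v := \<tau>)) T 0 \<phi>" for \<tau>
      by (rule QAllTr.IH[OF vars_agree_update[OF QAllTr.prems[unfolded hq_free.simps]]]) simp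
    then show ?case by simp
  next
    case (QBody \<psi>)
    have least: "(\<forall>m. \<not> m < k) \<longleftrightarrow> k = 0" for k :: nat by auto
    show ?case using QBody ht_sat_body_to_ht[of \<psi> x0 \<Pi> \<Sigma> c] by (simp add: least)
  qed
qed

section \<open>The case of no propositional variables\<close>

lemma ht_sentence_ex_no_props:
  fixes \<phi>\<^sub>H :: "'p hq"
  shows "\<exists>\<phi>. trace_prefixed \<phi> \<and> ht_sentence {} \<phi> \<and>
           (\<forall>T\<subseteq>traces {}. hq_models {} T \<phi>\<^sub>H \<longleftrightarrow> ht_models {} T \<phi>)"
proof -
  define tt :: "'p ht" where "tt = HExTime 0 (HEq 0 0)"
  define ne :: "'p ht" where "ne = HExT 0 tt"
  have T: "hq_models {} T \<phi>\<^sub>H \<longleftrightarrow>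
      (if T = {} then hq_models {} {} \<phi>\<^sub>H else hq_models {} {\<lambda>_. {}} \<phi>\<^sub>H)"
    if "T \<subseteq> traces {}" for T
  proof -
    have "T \<subseteq> {\<lambda>_. {}}" using that by (auto simp: traces_def fun_eq_iff)
    then have "T = {} \<or> T = {\<lambda>_. {}}" by blast
    then show ?thesis by auto
  qed
  have prefixed: "trace_prefixed tt" "trace_prefixed ne"
    unfolding ne_def tt_def by (blast intro: trace_prefixed.intros no_trace_quant.intros)+
  have ex: "\<exists>\<Pi>. \<forall>v::nat. \<Pi> v \<in> traces {}" by (rule exI[of _ "\<lambda>_ _. {}"]) (auto simp: traces_def)
  then have models: "ht_models {} T tt" "\<not> ht_models {} T (HNot tt)"
    "ht_models {} T ne \<longleftrightarrow> T \<noteq> {}" "ht_models {} T (HNot ne) \<longleftrightarrow> T = {}" for T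
    by (auto simp: ht_models_def tt_def ne_def)
  \<comment> \<open>\<open>a\<close> and \<open>b\<close> are the prescribed truth values for empty
    and nonempty \<open>T\<close>: \<open>tt\<close> and its negation give the constant tables,
    \<open>ne\<close> and its negation the other two.\<close>
  have "\<exists>\<phi>\<in>{tt, HNot tt, ne, HNot ne}. \<forall>T. (if T = {} then a else b) \<longleftrightarrow> ht_models {} T \<phi>" for a b
    by (cases a; cases b) (auto simp: models)
  then obtain \<phi> where \<phi>: "\<phi> \<in> {tt, HNot tt, ne, HNot ne}"
    "\<forall>T. (if T = {} then hq_models {} {} \<phi>\<^sub>H else hq_models {} {\<lambda>_. {}} \<phi>\<^sub>H) \<longleftrightarrow> ht_models {} T \<phi>"
    by blast
  have "trace_prefixed \<phi>" using \<phi>(1) prefixed trace_prefixed.intros(3) by auto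
  moreover have "ht_sentence {} \<phi>" using \<phi>(1) by (auto simp: ht_sentence_def tt_def ne_def)
  moreover have "\<forall>T\<subseteq>traces {}. hq_models {} T \<phi>\<^sub>H \<longleftrightarrow> ht_models {} T \<phi>"
  proof (intro allI impI)
    fix T :: "'p trace set" assume "T \<subseteq> traces {}"
    show "hq_models {} T \<phi>\<^sub>H \<longleftrightarrow> ht_models {} T \<phi>"
      unfolding T[OF \<open>T \<subseteq> traces {}\<close>] using \<phi>(2) by (rule spec)
  qed
  ultimately show ?thesis by blast
qed

lemma hq_sentence_imp_ht_sentence:
  assumes "hq_sentence X \<phi>\<^sub>H"
  shows "\<exists>\<phi>. trace_prefixed \<phi> \<and> ht_sentence X \<phi> \<and>
           (\<forall>T\<subseteq>traces X. hq_models X T \<phi>\<^sub>H \<longleftrightarrow> ht_models X T \<phi>)"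
proof (cases "X = {}")
  case True
  then show ?thesis using ht_sentence_ex_no_props by simp
next
  case False
  then obtain x0 where x0: "x0 \<in> X" by auto
  have closed: "hq_free \<phi>\<^sub>H = {}" "hq_idx_props \<phi>\<^sub>H \<subseteq> X"
    using assms by (auto simp: hq_sentence_def)
  define \<phi> where "\<phi> = hq_to_ht x0 (\<lambda>_. 0) 0 \<phi>\<^sub>H"
  \<comment> \<open>Without free variables the agreement hypothesis is vacuous. Hence any pair of
    assignments will do, and so will the starting map \<open>\<lambda>_. 0\<close> with bound
    0.\<close>
  have sat: "ht_sat X T \<Sigma> \<Theta> \<phi> \<longleftrightarrow> hq_sat \<Pi> T 0 \<phi>\<^sub>H" for T \<Sigma> \<Theta> \<Pi>
    unfolding \<phi>_def using ht_sat_hq_to_ht[OF x0] closed by blast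
  have "ht_sentence X \<phi>"
    using ht_props_hq_to_ht[of x0 "\<lambda>_. 0" 0 \<phi>\<^sub>H] ht_free_traces_hq_to_ht[of x0 "\<lambda>_. 0" 0 \<phi>\<^sub>H]
      closed x0 unfolding ht_sentence_def \<phi>_def ht_free_times_hq_to_ht by auto
  moreover have "hq_models X T \<phi>\<^sub>H \<longleftrightarrow> ht_models X T \<phi>" for T
  proof -
    \<comment> \<open>Admissible assignments exist on both sides, so the existential choice of an
      assignment in the two notions of model is harmless.\<close>
    have "(\<forall>v. (\<lambda>_ _. {}) v \<in> traces X)" "(\<forall>q. (\<lambda>_ _. {}) (PVar q) \<in> traces {q})"
      by (auto simp: traces_def)
    then show ?thesis unfolding hq_models_def ht_models_def using sat by meson
  qed
  moreover have "trace_prefixed \<phi>" unfolding \<phi>_def by (rule trace_prefixed_hq_to_ht)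
  ultimately show ?thesis by blast
qed


section \<open>From hypertrace logic to HyperQPTL\<close>

lemma hq_body_sat_cong:
  "(\<And>w. w \<in> hq_body_vars \<psi> \<Longrightarrow> \<Pi> w = \<Pi>' w) \<Longrightarrow> hq_body_sat \<Pi> T i \<psi> = hq_body_sat \<Pi>' T i \<psi>"
  by (induction \<psi> arbitrary: i) auto

lemma finite_hq_body_vars: "finite (hq_body_vars \<psi>)"
  by (induction \<psi>) auto

lemma finite_ht_free_traces: "finite (ht_free_traces \<phi>)"
  by (induction \<phi>) auto

lemma finite_ht_free_times: "finite (ht_free_times \<phi>)"
  by (induction \<phi>) auto

lemma finite_ht_props: "finite (ht_props \<phi>)"
  by (induction \<phi>) auto

abbreviation q_and :: "'p hq_body \<Rightarrow> 'p hq_body \<Rightarrow> 'p hq_body" where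
  "q_and \<phi> \<psi> \<equiv> QNot (QOr (QNot \<phi>) (QNot \<psi>))"

abbreviation q_eventually :: "'p hq_body \<Rightarrow> 'p hq_body" where
  "q_eventually \<psi> \<equiv> QUntil (QOr \<psi> (QNot \<psi>)) \<psi>"

definition q_once :: "'p \<Rightarrow> 'p hq_body" where
  "q_once q = QUntil (QNot (QProp q)) (q_and (QProp q) (QNot (QNext (q_eventually (QProp q)))))"

lemma q_once_vars [simp]: "hq_body_vars (q_once q) = {PVar q}" "hq_body_idx_props (q_once q) = {}"
  by (auto simp: q_once_def)

lemma hq_body_sat_q_once:
  "hq_body_sat \<Pi> T 0 (q_once q) \<longleftrightarrow> (\<exists>n. \<forall>k. q \<in> \<Pi> (PVar q) k \<longleftrightarrow> k = n)"
proof -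
  \<comment> \<open>Uniqueness is split into positions after \<open>n\<close> and before
    \<open>n\<close>, which the negated \<open>QNext\<close> and the left argument of the until in
    \<open>q_once\<close> express respectively.\<close>
  have "(\<forall>k. q \<in> \<Pi> (PVar q) k \<longleftrightarrow> k = n) \<longleftrightarrow>
          q \<in> \<Pi> (PVar q) n \<and> (\<forall>k\<ge>Suc n. q \<notin> \<Pi> (PVar q) k) \<and> (\<forall>k<n. q \<notin> \<Pi> (PVar q) k)" for n
    by (metis Suc_le_eq linorder_neqE_nat less_irrefl)
  then show ?thesis by (auto simp: q_once_def)
qed

subsection \<open>Prefixes of propositional quantifiers\<close>

text \<open>A pair with first component \<^term>\<open>True\<close> is an existential quantifier.\<close>

primrec prefix_props :: "(bool \<times> 'p) list \<Rightarrow> 'p hq_body \<Rightarrow> 'p hq" where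
  "prefix_props [] b = QBody b"
| "prefix_props (p # ps) b =
     (if fst p then QExProp (snd p) (prefix_props ps b) else QAllProp (snd p) (prefix_props ps b))"

abbreviation prefix_vars :: "(bool \<times> 'p) list \<Rightarrow> 'p hqvar set" where
  "prefix_vars ps \<equiv> PVar ` snd ` set ps"

lemma hq_free_prefix_props [simp]: "hq_free (prefix_props ps b) = hq_body_vars b - prefix_vars ps"
  by (induction ps) auto

lemma hq_idx_props_prefix_props [simp]: "hq_idx_props (prefix_props ps b) = hq_body_idx_props b"
  by (induction ps) auto

lemma hq_sat_prefix_props_cong:
  assumes "\<And>w. w \<in> hq_body_vars b \<Longrightarrow> \<Pi> w = \<Pi>' w"
  shows "hq_sat \<Pi> T i (prefix_props ps b) = hq_sat \<Pi>' T i (prefix_props ps b)"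
  using assms
proof (induction ps arbitrary: \<Pi> \<Pi>')
  case Nil
  then show ?case using hq_body_sat_cong[of b \<Pi> \<Pi>'] by simp
next
  case (Cons p ps)
  have "hq_sat (\<Pi>(PVar (snd p) := \<tau>)) T i (prefix_props ps b) =
        hq_sat (\<Pi>'(PVar (snd p) := \<tau>)) T i (prefix_props ps b)" for \<tau>
    by (rule Cons.IH) (simp add: Cons.prems)
  then show ?case by simp
qed

lemma hq_sat_prefix_props_not:
  "hq_sat \<Pi> T i (prefix_props (map (apfst Not) ps) (QNot b)) \<longleftrightarrow> \<not> hq_sat \<Pi> T i (prefix_props ps b)"
  by (induction ps arbitrary: \<Pi>) auto

lemma traces_nonempty: "\<exists>\<tau>. \<tau> \<in> traces X"
  by (rule exI[of _ "\<lambda>_. {}"]) (simp add: traces_def)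

text \<open>A quantifier over a proposition absent from \<open>b\<close> moves past
  \<open>b\<close>. For an existential quantifier this needs some \<open>\<tau>\<close> even when
  \<open>b\<close> alone makes the disjunction true; \<open>traces_nonempty\<close> supplies
  it.\<close>

lemma hq_sat_prefix_props_or_body:
  assumes "prefix_vars ps \<inter> hq_body_vars b = {}"
  shows "hq_sat \<Pi> T i (prefix_props ps (QOr b c)) \<longleftrightarrow>
           hq_body_sat \<Pi> T i b \<or> hq_sat \<Pi> T i (prefix_props ps c)"
  using assms
proof (induction ps arbitrary: \<Pi>)
  case (Cons p ps)
  have "hq_body_sat (\<Pi>(PVar (snd p) := \<tau>)) T i b = hq_body_sat \<Pi> T i b" for \<tau>
    by (rule hq_body_sat_cong) (use Cons.prems in auto)
  moreover have "prefix_vars ps \<inter> hq_body_vars b = {}" using Cons.prems by auto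
  ultimately show ?case
    using traces_nonempty[of "{snd p}"] by (auto simp: Cons.IH simp del: fun_upd_apply)
qed simp

text \<open>In the conjunctive form it is the universal quantifiers that need a nonempty
  range.\<close>

lemma hq_sat_prefix_props_and_body:
  assumes "prefix_vars ps \<inter> hq_body_vars b = {}"
  shows "hq_sat \<Pi> T i (prefix_props ps (q_and b c)) \<longleftrightarrow>
           hq_body_sat \<Pi> T i b \<and> hq_sat \<Pi> T i (prefix_props ps c)"
  using assms
proof (induction ps arbitrary: \<Pi>)
  case (Cons p ps)
  have "hq_body_sat (\<Pi>(PVar (snd p) := \<tau>)) T i b = hq_body_sat \<Pi> T i b" for \<tau>
    by (rule hq_body_sat_cong) (use Cons.prems in auto)
  moreover have "prefix_vars ps \<inter> hq_body_vars b = {}" using Cons.prems by auto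
  ultimately show ?case
    using traces_nonempty[of "{snd p}"] by (auto simp: Cons.IH simp del: fun_upd_apply)
qed simp

text \<open>The prefixes are merged one after the other: by induction \<open>ps\<close> passes over
  \<open>c\<close>, and in the base case \<open>qs\<close> passes over \<open>b\<close>.\<close>

lemma hq_sat_prefix_props_or:
  assumes "prefix_vars ps \<inter> hq_body_vars c = {}" and "prefix_vars qs \<inter> hq_body_vars b = {}"
  shows "hq_sat \<Pi> T i (prefix_props (ps @ qs) (QOr b c)) \<longleftrightarrow>
           hq_sat \<Pi> T i (prefix_props ps b) \<or> hq_sat \<Pi> T i (prefix_props qs c)"
  using assms(1)
proof (induction ps arbitrary: \<Pi>)
  case Nil
  then show ?case using hq_sat_prefix_props_or_body[OF assms(2)] by simp
next
  case (Cons p ps)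
  have "hq_sat (\<Pi>(PVar (snd p) := \<tau>)) T i (prefix_props qs c) = hq_sat \<Pi> T i (prefix_props qs c)" for \<tau>
    by (rule hq_sat_prefix_props_cong) (use Cons.prems in auto)
  moreover have "prefix_vars ps \<inter> hq_body_vars c = {}" using Cons.prems by auto
  ultimately show ?case
    using traces_nonempty[of "{snd p}"] by (auto simp: Cons.IH simp del: fun_upd_apply)
qed

subsection \<open>Time quantifiers\<close>

text \<open>Time variable \<open>i\<close> is represented by the proposition \<open>\<rho> i\<close>, and \<open>x\<close> on trace \<open>v\<close> by the
  formula \<open>\<alpha> v x\<close>.\<close>

definition rep_vars ::
  "(nat \<Rightarrow> 'p) \<Rightarrow> (nat \<Rightarrow> 'p \<Rightarrow> 'p hq_body) \<Rightarrow> 'p ht \<Rightarrow> 'p hqvar set" where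
  "rep_vars \<rho> \<alpha> \<phi> = PVar ` \<rho> ` ht_free_times \<phi> \<union>
     (\<Union>v\<in>ht_free_traces \<phi>. \<Union>x\<in>ht_props \<phi>. hq_body_vars (\<alpha> v x))"

definition rep_time :: "(nat \<Rightarrow> 'p) \<Rightarrow> 'p ht \<Rightarrow> ('p hqvar \<Rightarrow> 'p trace) \<Rightarrow> (nat \<Rightarrow> nat) \<Rightarrow> bool" where
  "rep_time \<rho> \<phi> \<Pi> \<Theta> \<longleftrightarrow> (\<forall>i\<in>ht_free_times \<phi>. \<forall>k. \<rho> i \<in> \<Pi> (PVar (\<rho> i)) k \<longleftrightarrow> k = \<Theta> i)"

text \<open>All positions \<open>k\<close> are compared because an atom is read below an eventually,
  at the position that its time variable denotes.\<close>

definition rep_trace ::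
  "(nat \<Rightarrow> 'p \<Rightarrow> 'p hq_body) \<Rightarrow> 'p ht \<Rightarrow> ('p hqvar \<Rightarrow> 'p trace) \<Rightarrow> 'p trace set \<Rightarrow> (nat \<Rightarrow> 'p trace) \<Rightarrow> bool"
  where "rep_trace \<alpha> \<phi> \<Pi> T \<Sigma> \<longleftrightarrow>
    (\<forall>v\<in>ht_free_traces \<phi>. \<forall>x\<in>ht_props \<phi>. \<forall>k. hq_body_sat \<Pi> T k (\<alpha> v x) \<longleftrightarrow> x \<in> \<Sigma> v k)"

text \<open>The syntactic bounds travel with the equivalence: the one on free variables keeps the
  two prefixes of a disjunction apart, and in the end both bounds show that the result is a
  sentence.\<close>

definition translates ::
  "'p set \<Rightarrow> (nat \<Rightarrow> 'p) \<Rightarrow> (nat \<Rightarrow> 'p \<Rightarrow> 'p hq_body) \<Rightarrow> 'p ht \<Rightarrow> 'p hq \<Rightarrow> bool" where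
  "translates X \<rho> \<alpha> \<phi> \<phi>' \<longleftrightarrow>
     hq_free \<phi>' \<subseteq> rep_vars \<rho> \<alpha> \<phi> \<and> hq_idx_props \<phi>' \<subseteq> ht_props \<phi> \<and>
     (\<forall>\<Pi> T \<Sigma> \<Theta>. rep_time \<rho> \<phi> \<Pi> \<Theta> \<longrightarrow> rep_trace \<alpha> \<phi> \<Pi> T \<Sigma> \<longrightarrow>
        (hq_sat \<Pi> T 0 \<phi>' \<longleftrightarrow> ht_sat X T \<Sigma> \<Theta> \<phi>))"

lemma finite_rep_vars: "finite (rep_vars \<rho> \<alpha> \<phi>)"
  by (simp add: rep_vars_def finite_ht_free_times finite_ht_free_traces finite_ht_props
      finite_hq_body_vars)

lemma atom_vars_subset_rep_vars:
  "v \<in> ht_free_traces \<phi> \<Longrightarrow> x \<in> ht_props \<phi> \<Longrightarrow> hq_body_vars (\<alpha> v x) \<subseteq> rep_vars \<rho> \<alpha> \<phi>"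
  by (auto simp: rep_vars_def)

lemma ex_fresh_prop:
  assumes "finite (V :: 'p::infinite hqvar set)"
  shows "\<exists>q. PVar q \<notin> V"
proof -
  have "finite (PVar -` V)" by (rule finite_vimageI[OF assms]) (simp add: inj_def)
  then show ?thesis using ex_new_if_finite[OF infinite_UNIV] by blast
qed

text \<open>A HyperQPTL body contains no quantifier, so every time quantifier has to reach the
  prefix. The set \<open>A\<close> of forbidden names is arbitrary so that the second disjunct can
  be asked to avoid the names chosen for the first.\<close>

lemma ex_prenex:
  fixes \<psi> :: "'p::infinite ht"
  assumes "no_trace_quant \<psi>" and "\<And>v x. hq_body_idx_props (\<alpha> v x) \<subseteq> {x}"
    and "finite A" and "rep_vars \<rho> \<alpha> \<psi> \<subseteq> A"
  shows "\<exists>ps b. prefix_vars ps \<inter> A = {} \<and> translates X \<rho> \<alpha> \<psi> (prefix_props ps b)"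
  using assms(1,3,4)
proof (induction arbitrary: \<rho> A)
  case (1 \<psi> i)
  obtain q where q: "PVar q \<notin> A" using ex_fresh_prop[OF 1(3)] by blast
  have vars: "rep_vars (\<rho>(i := q)) \<alpha> \<psi> \<subseteq> insert (PVar q) (rep_vars \<rho> \<alpha> (HExTime i \<psi>))"
    by (auto simp: rep_vars_def)
  have "rep_vars (\<rho>(i := q)) \<alpha> \<psi> \<subseteq> insert (PVar q) A"
    using vars 1(4) by blast
  from 1(2)[OF finite.insertI[OF 1(3)] this] obtain ps b
    where IH: "prefix_vars ps \<inter> insert (PVar q) A = {}"
      "translates X (\<rho>(i := q)) \<alpha> \<psi> (prefix_props ps b)"
    by blast
  have "hq_sat \<Pi> T 0 (prefix_props ((True, q) # ps) (q_and (q_once q) b)) \<longleftrightarrow>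
          ht_sat X T \<Sigma> \<Theta> (HExTime i \<psi>)"
    if time: "rep_time \<rho> (HExTime i \<psi>) \<Pi> \<Theta>" and trace: "rep_trace \<alpha> (HExTime i \<psi>) \<Pi> T \<Sigma>"
    for \<Pi> T \<Sigma> \<Theta>
  proof -
    \<comment> \<open>A trace in which \<open>q\<close> holds exactly at \<open>n\<close> stands for
      the value \<open>n\<close> of \<open>i\<close>. Freshness of \<open>q\<close> leaves all other
      representations untouched.\<close>
    have step: "hq_sat (\<Pi>(PVar q := \<tau>)) T 0 (prefix_props ps b) \<longleftrightarrow> ht_sat X T \<Sigma> (\<Theta>(i := n)) \<psi>"
      if n: "\<forall>k. q \<in> \<tau> k \<longleftrightarrow> k = n" for \<tau> n
    proof -
      have "q \<noteq> \<rho> j" if "j \<in> ht_free_times \<psi>" "j \<noteq> i" for j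
        using that q 1(4) by (auto simp: rep_vars_def)
      then have "rep_time (\<rho>(i := q)) \<psi> (\<Pi>(PVar q := \<tau>)) (\<Theta>(i := n))"
        using time n by (auto simp: rep_time_def)
      moreover have "hq_body_sat (\<Pi>(PVar q := \<tau>)) T k (\<alpha> v x) = hq_body_sat \<Pi> T k (\<alpha> v x)"
        if "v \<in> ht_free_traces \<psi>" "x \<in> ht_props \<psi>" for k v x
      proof (rule hq_body_sat_cong)
        fix w assume "w \<in> hq_body_vars (\<alpha> v x)"
        with that have "w \<in> A"
          using atom_vars_subset_rep_vars[of v "HExTime i \<psi>" x \<alpha> \<rho>] 1(4) by auto
        with q show "(\<Pi>(PVar q := \<tau>)) w = \<Pi> w" by auto
      qed
      then have "rep_trace \<alpha> \<psi> (\<Pi>(PVar q := \<tau>)) T \<Sigma>"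
        using trace by (simp add: rep_trace_def)
      ultimately show ?thesis using IH(2) by (simp add: translates_def)
    qed
    \<comment> \<open>Since \<open>ps\<close> avoids \<open>q\<close>, the conjunct
      \<open>q_once q\<close> can leave the scope of \<open>ps\<close> and becomes a restriction on
      \<open>\<tau>\<close>.\<close>
    have "prefix_vars ps \<inter> hq_body_vars (q_once q) = {}" using IH(1) by auto
    then have "hq_sat \<Pi> T 0 (prefix_props ((True, q) # ps) (q_and (q_once q) b)) \<longleftrightarrow>
       (\<exists>\<tau>\<in>traces {q}. (\<exists>n. \<forall>k. q \<in> \<tau> k \<longleftrightarrow> k = n) \<and>
          hq_sat (\<Pi>(PVar q := \<tau>)) T 0 (prefix_props ps b))"
      by (simp add: hq_sat_prefix_props_and_body hq_body_sat_q_once)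
    also have "\<dots> \<longleftrightarrow> (\<exists>n. ht_sat X T \<Sigma> (\<Theta>(i := n)) \<psi>)"
    proof
      assume "\<exists>n. ht_sat X T \<Sigma> (\<Theta>(i := n)) \<psi>"
      then obtain n where n: "ht_sat X T \<Sigma> (\<Theta>(i := n)) \<psi>" by blast
      let ?\<tau> = "\<lambda>k. if k = n then {q} else {}"
      have \<tau>: "\<forall>k. q \<in> ?\<tau> k \<longleftrightarrow> k = n" "?\<tau> \<in> traces {q}" by (auto simp: traces_def)
      show "\<exists>\<tau>\<in>traces {q}. (\<exists>n. \<forall>k. q \<in> \<tau> k \<longleftrightarrow> k = n) \<and>
          hq_sat (\<Pi>(PVar q := \<tau>)) T 0 (prefix_props ps b)"
        using step[OF \<tau>(1)] n \<tau> by blast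
    qed (use step in blast)
    finally show ?thesis by simp
  qed
  moreover have "hq_free (prefix_props ((True, q) # ps) (q_and (q_once q) b))
      \<subseteq> rep_vars \<rho> \<alpha> (HExTime i \<psi>)"
    using IH(2) vars by (auto simp: translates_def)
  moreover have "hq_idx_props (prefix_props ((True, q) # ps) (q_and (q_once q) b))
      \<subseteq> ht_props (HExTime i \<psi>)"
    using IH(2) by (auto simp: translates_def)
  ultimately have "translates X \<rho> \<alpha> (HExTime i \<psi>)
      (prefix_props ((True, q) # ps) (q_and (q_once q) b))"
    unfolding translates_def by blast
  moreover have "prefix_vars ((True, q) # ps) \<inter> A = {}" using IH(1) q by auto
  ultimately show ?case by blast
next
  case (2 \<psi>1 \<psi>2)
  have vars: "rep_vars \<rho> \<alpha> \<psi>1 \<union> rep_vars \<rho> \<alpha> \<psi>2 \<subseteq> rep_vars \<rho> \<alpha> (HOr \<psi>1 \<psi>2)"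
    by (auto simp: rep_vars_def)
  have "rep_vars \<rho> \<alpha> \<psi>1 \<subseteq> A"
    using vars 2(6) by blast
  from 2(3)[OF 2(5) this] obtain ps b
    where IH1: "prefix_vars ps \<inter> A = {}" "translates X \<rho> \<alpha> \<psi>1 (prefix_props ps b)"
    by blast
  have "finite (A \<union> prefix_vars ps)" "rep_vars \<rho> \<alpha> \<psi>2 \<subseteq> A \<union> prefix_vars ps"
    using vars 2(5,6) by auto
  from 2(4)[OF this] obtain qs c
    where IH2: "prefix_vars qs \<inter> (A \<union> prefix_vars ps) = {}"
      "translates X \<rho> \<alpha> \<psi>2 (prefix_props qs c)"
    by blast
  \<comment> \<open>\<open>B\<close> and \<open>C\<close> stand for the variables of the two bodies,
    \<open>P\<close> and \<open>Q\<close> for those of the two prefixes.\<close>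
  have sets: "B \<subseteq> A' \<union> P" "C \<subseteq> A' \<union> Q" "B \<union> C - (P \<union> Q) \<subseteq> R"
    if "B - P \<subseteq> R1" "C - Q \<subseteq> R2" "R1 \<union> R2 \<subseteq> R" "R \<subseteq> A'" for A' B C P Q R R1 R2 :: "'p hqvar set"
    using that by blast+
  have sub: "hq_body_vars b - prefix_vars ps \<subseteq> rep_vars \<rho> \<alpha> \<psi>1"
    "hq_body_vars c - prefix_vars qs \<subseteq> rep_vars \<rho> \<alpha> \<psi>2"
    "hq_body_idx_props b \<subseteq> ht_props \<psi>1" "hq_body_idx_props c \<subseteq> ht_props \<psi>2"
    using IH1(2) IH2(2) by (simp_all add: translates_def)
  note free = sets[OF sub(1,2) vars 2(6)]
  have disjoint: "P \<inter> C = {}" "Q \<inter> B = {}"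
    if "P \<inter> A = {}" "Q \<inter> (A \<union> P) = {}" "B \<subseteq> A \<union> P" "C \<subseteq> A \<union> Q" for B C P Q
    using that by blast+
  note or = hq_sat_prefix_props_or[OF disjoint[OF IH1(1) IH2(1) free(1,2)]]
  have "hq_sat \<Pi> T 0 (prefix_props (ps @ qs) (QOr b c)) \<longleftrightarrow> ht_sat X T \<Sigma> \<Theta> (HOr \<psi>1 \<psi>2)"
    if "rep_time \<rho> (HOr \<psi>1 \<psi>2) \<Pi> \<Theta>" "rep_trace \<alpha> (HOr \<psi>1 \<psi>2) \<Pi> T \<Sigma>" for \<Pi> T \<Sigma> \<Theta>
  proof -
    have "rep_time \<rho> \<psi>1 \<Pi> \<Theta>" "rep_time \<rho> \<psi>2 \<Pi> \<Theta>" using that(1) by (simp_all add: rep_time_def)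
    moreover have "rep_trace \<alpha> \<psi>1 \<Pi> T \<Sigma>" "rep_trace \<alpha> \<psi>2 \<Pi> T \<Sigma>"
      using that(2) by (simp_all add: rep_trace_def)
    ultimately show ?thesis using IH1(2) IH2(2) by (simp add: translates_def or)
  qed
  then have "translates X \<rho> \<alpha> (HOr \<psi>1 \<psi>2) (prefix_props (ps @ qs) (QOr b c))"
    using free(3) sub(3,4) by (simp add: translates_def image_Un le_supI1 le_supI2)
  moreover have "prefix_vars (ps @ qs) \<inter> A = {}"
    using IH1(1) IH2(1) by (simp add: image_Un Int_Un_distrib Int_Un_distrib2)
  ultimately show ?case by blast
next
  case (3 \<psi>)
  have "rep_vars \<rho> \<alpha> \<psi> \<subseteq> A" using 3(4) by (simp add: rep_vars_def)
  from 3(2)[OF 3(3) this] obtain ps b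
    where IH: "prefix_vars ps \<inter> A = {}" "translates X \<rho> \<alpha> \<psi> (prefix_props ps b)"
    by blast
  \<comment> \<open>Dualising changes the kind of each quantifier but no name.\<close>
  have "prefix_vars (map (apfst Not) ps) = prefix_vars ps" by (simp add: image_image)
  moreover from this have "translates X \<rho> \<alpha> (HNot \<psi>) (prefix_props (map (apfst Not) ps) (QNot b))"
    using IH(2) hq_sat_prefix_props_not[of _ _ 0 ps b]
    by (simp add: translates_def rep_vars_def rep_time_def rep_trace_def)
  ultimately show ?case using IH(1) by metis
next
  case (4 i j)
  \<comment> \<open>Every atom is evaluated from position 0 by moving to the unique position of
    \<open>\<rho> i\<close>; here the extra \<open>QNext\<close> makes the comparison
    strict.\<close>
  have "translates X \<rho> \<alpha> (HLess i j)
     (prefix_props [] (q_eventually (q_and (QProp (\<rho> i)) (QNext (q_eventually (QProp (\<rho> j)))))))"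
    by (auto simp: translates_def rep_vars_def rep_time_def Suc_le_eq)
  then show ?case by (intro exI[of _ "[]"]) auto
next
  case (5 i j)
  have "translates X \<rho> \<alpha> (HEq i j)
     (prefix_props [] (q_eventually (q_and (QProp (\<rho> i)) (QProp (\<rho> j)))))"
    by (auto simp: translates_def rep_vars_def rep_time_def)
  then show ?case by (intro exI[of _ "[]"]) auto
next
  case (6 x v i)
  have "translates X \<rho> \<alpha> (HProp x v i)
     (prefix_props [] (q_eventually (q_and (QProp (\<rho> i)) (\<alpha> v x))))"
    using assms(2)[of v x] by (auto simp: translates_def rep_vars_def rep_time_def rep_trace_def)
  then show ?case by (intro exI[of _ "[]"]) auto
qed

subsection \<open>Trace quantifiers\<close>

text \<open>HyperQPTL allows negation only inside bodies, so the negation of a quantified formula is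
  pushed through its prefix by duality.\<close>

primrec hq_neg :: "'p hq \<Rightarrow> 'p hq" where
  "hq_neg (QExProp q \<phi>) = QAllProp q (hq_neg \<phi>)"
| "hq_neg (QAllProp q \<phi>) = QExProp q (hq_neg \<phi>)"
| "hq_neg (QExTr v \<phi>) = QAllTr v (hq_neg \<phi>)"
| "hq_neg (QAllTr v \<phi>) = QExTr v (hq_neg \<phi>)"
| "hq_neg (QBody \<psi>) = QBody (QNot \<psi>)"

lemma hq_sat_hq_neg [simp]: "hq_sat \<Pi> T i (hq_neg \<phi>) \<longleftrightarrow> \<not> hq_sat \<Pi> T i \<phi>"
  by (induction \<phi> arbitrary: \<Pi>) auto

lemma hq_free_hq_neg [simp]: "hq_free (hq_neg \<phi>) = hq_free \<phi>"
  by (induction \<phi>) auto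

lemma hq_idx_props_hq_neg [simp]: "hq_idx_props (hq_neg \<phi>) = hq_idx_props \<phi>"
  by (induction \<phi>) auto

lemma hq_free_foldr_QExProp [simp]: "hq_free (foldr QExProp qs \<phi>) = hq_free \<phi> - PVar ` set qs"
  by (induction qs) auto

lemma hq_idx_props_foldr_QExProp [simp]: "hq_idx_props (foldr QExProp qs \<phi>) = hq_idx_props \<phi>"
  by (induction qs) auto

text \<open>The whole block amounts to one change of assignment, so that a quantified trace can be
  encoded or decoded in a single move.\<close>

lemma hq_sat_foldr_QExProp:
  "hq_sat \<Pi> T i (foldr QExProp qs \<phi>) \<longleftrightarrow>
     (\<exists>\<Pi>'. (\<forall>q\<in>set qs. \<Pi>' (PVar q) \<in> traces {q}) \<and> (\<forall>w. w \<notin> PVar ` set qs \<longrightarrow> \<Pi>' w = \<Pi> w) \<and>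
        hq_sat \<Pi>' T i \<phi>)"
proof (induction qs arbitrary: \<Pi>)
  case Nil
  have "(\<forall>w. \<Pi>' w = \<Pi> w) \<longleftrightarrow> \<Pi>' = \<Pi>" for \<Pi>' by (simp add: fun_eq_iff)
  then show ?case by simp
next
  case (Cons q qs)
  show ?case (is "?L \<longleftrightarrow> ?R")
  proof
    assume ?L
    then obtain \<tau> \<Pi>' where "\<tau> \<in> traces {q}" "\<forall>p\<in>set qs. \<Pi>' (PVar p) \<in> traces {p}"
      "\<forall>w. w \<notin> PVar ` set qs \<longrightarrow> \<Pi>' w = (\<Pi>(PVar q := \<tau>)) w" "hq_sat \<Pi>' T i \<phi>"
      by (auto simp: Cons.IH)
    \<comment> \<open>If \<open>q\<close> recurs in \<open>qs\<close>, its later binding overrides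
      \<open>\<tau>\<close>; otherwise \<open>\<Pi>'\<close> still has \<open>\<tau>\<close> at
      \<open>PVar q\<close>.\<close>
    then show ?R by (intro exI[of _ \<Pi>']) (cases "q \<in> set qs"; auto)
  next
    assume ?R
    then obtain \<Pi>' where *: "\<forall>p\<in>set (q # qs). \<Pi>' (PVar p) \<in> traces {p}"
      "\<forall>w. w \<notin> PVar ` set (q # qs) \<longrightarrow> \<Pi>' w = \<Pi> w" "hq_sat \<Pi>' T i \<phi>"
      by blast
    then have "hq_sat (\<Pi>(PVar q := \<Pi>' (PVar q))) T i (foldr QExProp qs \<phi>)"
      unfolding Cons.IH by (intro exI[of _ \<Pi>']) auto
    then show ?L using *(1) by auto
  qed
qed

lemma ex_fresh_props:
  assumes "finite (V :: 'p::infinite hqvar set)" and "finite X"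
  shows "\<exists>r :: 'a \<Rightarrow> 'p. inj_on r X \<and> PVar ` r ` X \<inter> V = {}"
proof -
  have "finite (PVar -` V)" by (rule finite_vimageI[OF assms(1)]) (simp add: inj_def)
  then have "infinite (- (PVar -` V))"
    using infinite_UNIV Diff_infinite_finite by (metis Compl_eq_Diff_UNIV)
  then obtain B where B: "finite B" "card B = card X" "B \<subseteq> - (PVar -` V)"
    by (meson infinite_arbitrarily_large)
  then obtain r where "bij_betw r X B"
    using assms(2) finite_same_card_bij by metis
  then show ?thesis using B(3) by (intro exI[of _ r]) (auto simp: bij_betw_def)
qed

text \<open>\<open>\<alpha>\<close> records how each enclosing trace quantifier was translated, by
  propositions or by a trace variable. The last hypothesis lets a trace be bound to
  \<open>TVar v\<close> without disturbing the formulas for other traces.\<close>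

lemma ex_hq_translation:
  fixes \<phi> :: "'p::infinite ht"
  assumes "finite X" and "trace_prefixed \<phi>" and "ht_props \<phi> \<subseteq> X"
    and "\<And>v x. hq_body_idx_props (\<alpha> v x) \<subseteq> {x}"
    and "\<And>u v x. TVar u \<in> hq_body_vars (\<alpha> v x) \<Longrightarrow> u = v"
  shows "\<exists>\<phi>'. translates X \<rho> \<alpha> \<phi> \<phi>'"
  using assms(2-)
proof (induction arbitrary: \<alpha>)
  case (1 \<phi> v)
  obtain r where r: "inj_on r X" "PVar ` r ` X \<inter> rep_vars \<rho> \<alpha> (HExAll v \<phi>) = {}"
    using ex_fresh_props[OF finite_rep_vars \<open>finite X\<close>] by metis
  obtain xs where xs: "set xs = X" using finite_list[OF \<open>finite X\<close>] by blast
  let ?\<alpha> = "\<alpha>(v := \<lambda>x. QProp (r x))"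
  have "\<exists>\<phi>'. translates X \<rho> ?\<alpha> \<phi> \<phi>'"
    by (rule 1(2)) (use 1(3-) in \<open>auto split: if_splits\<close>)
  then obtain \<phi>' where IH: "translates X \<rho> ?\<alpha> \<phi> \<phi>'" ..
  have "hq_sat \<Pi> T 0 (foldr QExProp (map r xs) \<phi>') \<longleftrightarrow> ht_sat X T \<Sigma> \<Theta> (HExAll v \<phi>)"
    if time: "rep_time \<rho> (HExAll v \<phi>) \<Pi> \<Theta>" and trace: "rep_trace \<alpha> (HExAll v \<phi>) \<Pi> T \<Sigma>"
    for \<Pi> T \<Sigma> \<Theta>
  proof -
    have step: "hq_sat \<Pi>' T 0 \<phi>' \<longleftrightarrow> ht_sat X T (\<Sigma>(v := \<tau>)) \<Theta> \<phi>"
      if \<Pi>': "\<forall>w. w \<notin> PVar ` r ` X \<longrightarrow> \<Pi>' w = \<Pi> w"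
        and \<tau>: "\<forall>x\<in>X. \<forall>k. r x \<in> \<Pi>' (PVar (r x)) k \<longleftrightarrow> x \<in> \<tau> k" for \<Pi>' \<tau>
    proof -
      have same: "\<Pi>' w = \<Pi> w" if "w \<in> rep_vars \<rho> \<alpha> (HExAll v \<phi>)" for w
        using that r(2) \<Pi>' by blast
      then have "rep_time \<rho> \<phi> \<Pi>' \<Theta>"
        using time by (auto simp: rep_time_def rep_vars_def)
      moreover have "hq_body_sat \<Pi>' T k (\<alpha> u x) = hq_body_sat \<Pi> T k (\<alpha> u x)"
        if "u \<in> ht_free_traces \<phi> - {v}" "x \<in> ht_props \<phi>" for k u x
      proof (rule hq_body_sat_cong, rule same)
        fix w assume "w \<in> hq_body_vars (\<alpha> u x)"
        with that show "w \<in> rep_vars \<rho> \<alpha> (HExAll v \<phi>)"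
          using atom_vars_subset_rep_vars[of u "HExAll v \<phi>" x \<alpha> \<rho>] by auto
      qed
      then have "rep_trace ?\<alpha> \<phi> \<Pi>' T (\<Sigma>(v := \<tau>))"
        using trace \<tau> 1(3) by (auto simp: rep_trace_def)
      ultimately show ?thesis using IH by (simp add: translates_def)
    qed
    show ?thesis
    proof
      assume "hq_sat \<Pi> T 0 (foldr QExProp (map r xs) \<phi>')"
      then obtain \<Pi>' where \<Pi>': "\<forall>w. w \<notin> PVar ` r ` X \<longrightarrow> \<Pi>' w = \<Pi> w" "hq_sat \<Pi>' T 0 \<phi>'"
        unfolding hq_sat_foldr_QExProp using xs by auto
      \<comment> \<open>The trace is decoded from the quantified propositions; collecting only
        elements of \<open>X\<close> puts it in \<open>traces X\<close>.\<close>
      let ?\<tau> = "\<lambda>k. {x \<in> X. r x \<in> \<Pi>' (PVar (r x)) k}"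
      have "?\<tau> \<in> traces X" by (auto simp: traces_def)
      moreover have "ht_sat X T (\<Sigma>(v := ?\<tau>)) \<Theta> \<phi>"
        using step[OF \<Pi>'(1), of ?\<tau>] \<Pi>'(2) by simp
      ultimately show "ht_sat X T \<Sigma> \<Theta> (HExAll v \<phi>)" by auto
    next
      assume "ht_sat X T \<Sigma> \<Theta> (HExAll v \<phi>)"
      then obtain \<tau> where \<tau>: "ht_sat X T (\<Sigma>(v := \<tau>)) \<Theta> \<phi>" by auto
      \<comment> \<open>The trace is encoded: injectivity of \<open>r\<close> makes
        \<open>r x\<close> hold at \<open>k\<close> exactly when \<open>x \<in> \<tau> k\<close>,
        and the condition \<open>w = PVar q\<close> keeps the value of each \<open>PVar q\<close> in
        \<open>traces {q}\<close>.\<close>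
      define \<Pi>' where "\<Pi>' w = (if w \<in> PVar ` r ` X
          then (\<lambda>k. {q. w = PVar q \<and> q \<in> r ` (X \<inter> \<tau> k)}) else \<Pi> w)" for w
      have eq: "r x \<in> r ` (X \<inter> \<tau> k) \<longleftrightarrow> x \<in> \<tau> k" if "x \<in> X" for x k
        using that r(1) by (auto simp: inj_on_def)
      have "hq_sat \<Pi>' T 0 \<phi>'"
        using step[of \<Pi>' \<tau>] \<tau> eq by (simp add: \<Pi>'_def)
      then show "hq_sat \<Pi> T 0 (foldr QExProp (map r xs) \<phi>')"
        unfolding hq_sat_foldr_QExProp
        by (intro exI[of _ \<Pi>']) (auto simp: xs \<Pi>'_def traces_def)
    qed
  qed
  moreover have "hq_free (foldr QExProp (map r xs) \<phi>') \<subseteq> rep_vars \<rho> \<alpha> (HExAll v \<phi>)"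
  proof -
    have "rep_vars \<rho> ?\<alpha> \<phi> \<subseteq> rep_vars \<rho> \<alpha> (HExAll v \<phi>) \<union> PVar ` r ` X"
      using 1(3) by (auto simp: rep_vars_def split: if_splits)
    then show ?thesis using IH xs by (auto simp: translates_def)
  qed
  ultimately have "translates X \<rho> \<alpha> (HExAll v \<phi>) (foldr QExProp (map r xs) \<phi>')"
    using IH by (simp add: translates_def)
  then show ?case by blast
next
  case (2 \<phi> v)
  let ?\<alpha> = "\<alpha>(v := \<lambda>x. QIdx x v)"
  have "\<exists>\<phi>'. translates X \<rho> ?\<alpha> \<phi> \<phi>'"
    by (rule 2(2)) (use 2(3-) in \<open>auto split: if_splits\<close>)
  then obtain \<phi>' where IH: "translates X \<rho> ?\<alpha> \<phi> \<phi>'" ..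
  have step: "hq_sat (\<Pi>(TVar v := \<tau>)) T 0 \<phi>' \<longleftrightarrow> ht_sat X T (\<Sigma>(v := \<tau>)) \<Theta> \<phi>"
    if time: "rep_time \<rho> (HExT v \<phi>) \<Pi> \<Theta>" and trace: "rep_trace \<alpha> (HExT v \<phi>) \<Pi> T \<Sigma>"
    for \<Pi> T \<Sigma> \<Theta> \<tau>
  proof -
    \<comment> \<open>For \<open>u \<noteq> v\<close> the formula \<open>\<alpha> u x\<close> cannot
      mention \<open>TVar v\<close>.\<close>
    have "hq_body_sat (\<Pi>(TVar v := \<tau>)) T k (\<alpha> u x) = hq_body_sat \<Pi> T k (\<alpha> u x)" if "u \<noteq> v" for k u x
      by (rule hq_body_sat_cong) (use that 2(5)[of v u x] in auto)
    then have "rep_trace ?\<alpha> \<phi> (\<Pi>(TVar v := \<tau>)) T (\<Sigma>(v := \<tau>))"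
      using trace by (auto simp: rep_trace_def)
    moreover have "rep_time \<rho> \<phi> (\<Pi>(TVar v := \<tau>)) \<Theta>"
      using time by (simp add: rep_time_def)
    ultimately show ?thesis using IH by (simp add: translates_def)
  qed
  have "rep_vars \<rho> ?\<alpha> \<phi> \<subseteq> insert (TVar v) (rep_vars \<rho> \<alpha> (HExT v \<phi>))"
    by (auto simp: rep_vars_def split: if_splits)
  then have "translates X \<rho> \<alpha> (HExT v \<phi>) (QExTr v \<phi>')"
    using IH step by (auto simp: translates_def)
  then show ?case by blast
next
  case (3 \<phi>)
  then obtain \<phi>' where "translates X \<rho> \<alpha> \<phi> \<phi>'" by fastforce
  then have "translates X \<rho> \<alpha> (HNot \<phi>) (hq_neg \<phi>')"
    by (simp add: translates_def rep_vars_def rep_time_def rep_trace_def)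
  then show ?case by blast
next
  case (4 \<psi>)
  from ex_prenex[where X = X and \<rho> = \<rho> and \<alpha> = \<alpha>, OF 4(1) 4(3) finite_rep_vars order_refl]
  obtain ps b where "translates X \<rho> \<alpha> \<psi> (prefix_props ps b)" by auto
  then show ?case ..
qed

section \<open>Sentences, and both directions together\<close>

lemma ht_sentence_imp_hq_sentence:
  fixes X :: "'p::infinite set"
  assumes "finite X" "trace_prefixed \<phi>" "ht_sentence X \<phi>"
  shows "\<exists>\<phi>\<^sub>H. hq_sentence X \<phi>\<^sub>H \<and> (\<forall>T. hq_models X T \<phi>\<^sub>H \<longleftrightarrow> ht_models X T \<phi>)"
proof -
  have closed: "ht_props \<phi> \<subseteq> X" "ht_free_traces \<phi> = {}" "ht_free_times \<phi> = {}"
    using assms(3) by (auto simp: ht_sentence_def)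
  \<comment> \<open>A sentence has no free variables to represent, so \<open>\<rho>\<close> may be
    anything and \<open>\<alpha>\<close> need only meet the side conditions of the
    translation.\<close>
  have "\<exists>\<phi>'. translates X undefined (\<lambda>v x. QIdx x v) \<phi> \<phi>'"
    by (rule ex_hq_translation[OF assms(1,2) closed(1)]) auto
  then obtain \<phi>' where \<phi>': "translates X undefined (\<lambda>v x. QIdx x v) \<phi> \<phi>'" ..
  have "hq_sentence X \<phi>'"
    using \<phi>' closed by (auto simp: translates_def rep_vars_def hq_sentence_def)
  moreover have "hq_models X T \<phi>' \<longleftrightarrow> ht_models X T \<phi>" for T
  proof -
    have "hq_sat \<Pi> T 0 \<phi>' \<longleftrightarrow> ht_sat X T \<Sigma> \<Theta> \<phi>" for \<Pi> \<Sigma> \<Theta>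
      using \<phi>' closed by (simp add: translates_def rep_time_def rep_trace_def)
    moreover have "(\<forall>v. (\<lambda>_ _. {}) v \<in> traces X)" "(\<forall>q. (\<lambda>_ _. {}) (PVar q) \<in> traces {q})"
      by (auto simp: traces_def)
    ultimately show ?thesis unfolding hq_models_def ht_models_def by meson
  qed
  ultimately show ?thesis by blast
qed

theorem theorem5:
  fixes X :: "'p::infinite set"
  assumes "finite X"
  shows "(\<forall>\<phi>\<^sub>H. hq_sentence X \<phi>\<^sub>H \<longrightarrow>
            (\<exists>\<phi>. trace_prefixed \<phi> \<and> ht_sentence X \<phi> \<and>
               (\<forall>T\<subseteq>traces X. hq_models X T \<phi>\<^sub>H \<longleftrightarrow> ht_models X T \<phi>)))
       \<and> (\<forall>\<phi>. trace_prefixed \<phi> \<and> ht_sentence X \<phi> \<longrightarrow>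
            (\<exists>\<phi>\<^sub>H. hq_sentence X \<phi>\<^sub>H \<and>
               (\<forall>T\<subseteq>traces X. hq_models X T \<phi>\<^sub>H \<longleftrightarrow> ht_models X T \<phi>)))"
proof (intro conjI allI impI, goal_cases)
  case (1 \<phi>\<^sub>H)
  then show ?case by (rule hq_sentence_imp_ht_sentence)
next
  case (2 \<phi>)
  with ht_sentence_imp_hq_sentence[OF assms, of \<phi>] show ?case by metis
qed

end
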